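(* For any graph $H$, there is a multigraph $H'$ such that the disjoint union $H\cup H'$ is KNRS.
   Context: Graphs and multigraphs are finite and loopless; $e(H)$ counts edges with multiplicity. A graphon is a symmetric measurable function $W:[0,1]^2\to[0,1]$. For a (multi)graph $H$ and a graphon $W$, $$t(H,W)=\int_{[0,1]^{V(H)}}\prod_{ij\in E(H)}W(x_i,x_j)\prod_{i\in V(H)}dx_i,$$ with the product over edges taken with multiplicity. For $\rho\in[0,1]$, a graphon $W$ is $\rho$-locally dense if $\int_{S\times S}W(x,y)\,dx\,dy\ge\rho\,\lambda(S)^2$ for every measurable $S\subseteq[0,1]$, where $\lambda$ is Lebesgue measure. A (multi)graph $H$ is KNRS if $t(H,W)\ge\rho^{e(H)}$ for every $\rho\in[0,1]$ and every $\rho$-locally dense graphon $W$. *)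

theory Defs
  imports "HOL-Analysis.Analysis" "HOL-Library.Multiset"
begin

record 'a multigraph =
  verts :: "'a set"
  edges :: "'a set multiset"

text \<open>The condition \<open>card e = 2\<close> excludes loops.\<close>

definition is_multigraph :: "'a multigraph \<Rightarrow> bool" where
  "is_multigraph H \<longleftrightarrow> finite (verts H) \<and> (\<forall>e\<in>#edges H. e \<subseteq> verts H \<and> card e = 2)"

definition is_simple_graph :: "'a multigraph \<Rightarrow> bool" where
  "is_simple_graph H \<longleftrightarrow> is_multigraph H \<and> (\<forall>e. count (edges H) e \<le> 1)"

definition disjoint_union :: "'a multigraph \<Rightarrow> 'b multigraph \<Rightarrow> ('a + 'b) multigraph" where
  "disjoint_union G H =
     \<lparr> verts = verts G <+> verts H,
       edges = image_mset (image Inl) (edges G) + image_mset (image Inr) (edges H) \<rparr>"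

lemma is_multigraph_disjoint_union:
  assumes "is_multigraph G" and "is_multigraph H"
  shows "is_multigraph (disjoint_union G H)"
  using assms by (auto simp: is_multigraph_def disjoint_union_def card_image)

text \<open>Graphons are total functions on the plane whose values outside the unit square are
  irrelevant. Measurability is in the sense of Lebesgue, not just of Borel.\<close>

definition graphon :: "(real \<Rightarrow> real \<Rightarrow> real) \<Rightarrow> bool" where
  "graphon W \<longleftrightarrow>
     (\<lambda>z. W (fst z) (snd z)) \<in> borel_measurable (lebesgue_on ({0..1} \<times> {0..1})) \<and>
     (\<forall>x\<in>{0..1}. \<forall>y\<in>{0..1}. W x y \<in> {0..1} \<and> W x y = W y x)"

definition locally_dense :: "real \<Rightarrow> (real \<Rightarrow> real \<Rightarrow> real) \<Rightarrow> bool" where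
  "locally_dense \<rho> W \<longleftrightarrow>
     (\<forall>S\<in>sets lebesgue. S \<subseteq> {0..1} \<longrightarrow>
        (LINT z:S \<times> S|lebesgue. W (fst z) (snd z)) \<ge> \<rho> * (measure lebesgue S)\<^sup>2)"

text \<open>The factor \<open>W (x i) (x j)\<close> contributed by the edge \<open>{i, j}\<close>; by symmetry of \<open>W\<close> it does
  not depend on the order of the end points.\<close>

definition edge_weight :: "(real \<Rightarrow> real \<Rightarrow> real) \<Rightarrow> ('a \<Rightarrow> real) \<Rightarrow> 'a set \<Rightarrow> real" where
  "edge_weight W x e = (THE w. \<exists>i j. e = {i, j} \<and> w = W (x i) (x j))"

lemma edge_weight_doubleton:
  assumes "graphon W" and "x i \<in> {0..1}" and "x j \<in> {0..1}"
  shows "edge_weight W x {i, j} = W (x i) (x j)"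
proof -
  have "W (x i) (x j) = W (x j) (x i)"
    using assms by (auto simp: graphon_def)
  then show ?thesis
    unfolding edge_weight_def by (intro the_equality) (auto simp: doubleton_eq_iff)
qed

text \<open>The product measure is completed so that \<open>x \<mapsto> W (x i) (x j)\<close> is measurable also for a
  graphon \<open>W\<close> that is Lebesgue but not Borel measurable.\<close>

definition hom_density :: "'a multigraph \<Rightarrow> (real \<Rightarrow> real \<Rightarrow> real) \<Rightarrow> real" where
  "hom_density H W =
     (LINT x|completion (\<Pi>\<^sub>M i\<in>verts H. restrict_space lborel {0..1}).
        (\<Prod>e\<in>#edges H. edge_weight W x e))"

definition KNRS :: "'a multigraph \<Rightarrow> bool" where
  "KNRS H \<longleftrightarrow>
     (\<forall>\<rho>\<in>{0..1}. \<forall>W. graphon W \<longrightarrow> locally_dense \<rho> W \<longrightarrow>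
        hom_density H W \<ge> \<rho> ^ size (edges H))"

end

theory Submission
  imports Defs "HOL-Probability.Infinite_Product_Measure"
begin

text \<open>
  Let \<open>V\<close> be the vertex set of \<open>H\<close>, with \<open>n\<close> elements. The multigraph \<open>H'\<close> is what remains of
  the doubled complete graph \<open>2 K\<^sub>n\<close> on \<open>V\<close> when the edges of \<open>H\<close> are taken away once. The integrands
  of \<open>t(H, W)\<close> and \<open>t(H', W)\<close> over the same variables then multiply to the square of the integrand of
  \<open>t(K\<^sub>n, W)\<close>, so the Cauchy--Schwarz inequality gives
  \<open>t(H, W) t(H', W) \<ge> t(K\<^sub>n, W)\<^sup>2\<close>. The left-hand side is the density of the disjoint union, which has
  exactly \<open>2 (n choose 2)\<close> edges, so it remains to see that complete graphs are KNRS.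

  For this one proves more: for every weight \<open>f\<close> with values in \<open>[0, 1]\<close>, the integral of
  \<open>f(x\<^sub>1) \<dots> f(x\<^sub>n) \<Prod> W(x\<^sub>i, x\<^sub>j)\<close> is at least \<open>\<rho>\<close> to the power \<open>n choose 2\<close> times \<open>(\<integral>f)\<^sup>n\<close>
  (\<open>weighted_clique_density\<close>). In the induction on \<open>n\<close> one vertex is placed at \<open>y\<close>, and the
  hypothesis is applied to the others with the weight \<open>f(t) W(y, t)\<close>; convexity of the power
  function then reduces the step to the case of one edge, \<open>\<integral>\<integral> f(x) f(y) W(x, y) \<ge> \<rho> (\<integral>f)\<^sup>2\<close>
  (\<open>weighted_dense\<close>). Local density is this inequality for indicator functions. It passes to weights
  because \<open>f\<close> is a weak limit of indicator functions: cut the unit interval into \<open>m\<close> cells of equal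
  length and in each of them replace \<open>f\<close> by an interval that has the mass of \<open>f\<close> on the cell
  (\<open>bunched_set_weak_limit\<close>).

  A Lebesgue measurable graphon is first replaced by a Borel measurable one that agrees with it almost
  everywhere. This changes neither the hom densities nor local density, and after it Fubini's theorem
  applies to the product measures without completion.
\<close>

section \<open>The unit interval\<close>

abbreviation unit_lborel :: "real measure" where
  "unit_lborel \<equiv> restrict_space lborel {0..1}"

lemma space_unit_lborel: "space unit_lborel = {0..1}"
  by (simp add: space_restrict_space)

lemma prob_space_unit_lborel: "prob_space unit_lborel"
  by (rule prob_spaceI) (simp add: emeasure_restrict_space space_restrict_space)

interpretation unit_lborel: prob_space unit_lborel
  by (rule prob_space_unit_lborel)

lemma measurable_unit_lborel [measurable (raw)]:
  "f \<in> measurable borel N \<Longrightarrow> f \<in> measurable unit_lborel N"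
  by (simp add: measurable_restrict_space1)

lemma measurable_fst_unit_lborel [measurable]: "fst \<in> borel_measurable (unit_lborel \<Otimes>\<^sub>M N)"
  and measurable_snd_unit_lborel [measurable]: "snd \<in> borel_measurable (N \<Otimes>\<^sub>M unit_lborel)"
  using measurable_compose[OF measurable_fst measurable_unit_lborel[OF measurable_ident]]
    measurable_compose[OF measurable_snd measurable_unit_lborel[OF measurable_ident]]
  by simp_all

lemma integrable_unit_lborel:
  fixes f :: "real \<Rightarrow> real"
  assumes "f \<in> borel_measurable unit_lborel" "\<And>x. x \<in> {0..1} \<Longrightarrow> \<bar>f x\<bar> \<le> B"
  shows "integrable unit_lborel f"
  using assms by (intro unit_lborel.integrable_const_bound[of _ B] AE_I2) (auto simp: space_unit_lborel)

section \<open>Sets that imitate a weight function\<close>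

definition cell :: "nat \<Rightarrow> nat \<Rightarrow> real set" where
  "cell n k = {k / n ..< (k + 1) / n}"

definition cell_mass :: "(real \<Rightarrow> real) \<Rightarrow> nat \<Rightarrow> nat \<Rightarrow> real" where
  "cell_mass f n k = (LINT x|unit_lborel. indicator (cell n k) x * f x)"

text \<open>In each cell the mass of \<open>f\<close> is pushed to the left end point and packed there with density 1.
  For \<open>f\<close> with values in \<open>[0, 1]\<close> the packed mass stays inside its cell.\<close>

definition bunched_set :: "(real \<Rightarrow> real) \<Rightarrow> nat \<Rightarrow> real set" where
  "bunched_set f n = (\<Union>k<n. {k / n ..< k / n + cell_mass f n k})"

lemma cell_borel [measurable]: "cell n k \<in> sets borel"
  by (simp add: cell_def)

lemma bunched_set_borel [measurable]: "bunched_set f n \<in> sets borel"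
  by (simp add: bunched_set_def)

lemma cell_subset: "k < n \<Longrightarrow> cell n k \<subseteq> {0..1}"
proof -
  assume "k < n"
  then have "real (k + 1) / n \<le> 1" by (simp add: divide_simps)
  moreover have "0 \<le> real k / n" by simp
  ultimately show ?thesis unfolding cell_def atLeastLessThan_subseteq_atLeastAtMost_iff
    by (simp add: add.commute)
qed

lemma cell_disjoint:
  assumes "x \<in> cell n j" "x \<in> cell n k"
  shows "j = k"
proof (cases "n = 0")
  case False
  then have "real j \<le> n * x" "n * x < real j + 1" "real k \<le> n * x" "n * x < real k + 1"
    using assms by (auto simp: cell_def field_simps)
  then show ?thesis by linarith
qed (use assms in \<open>simp add: cell_def\<close>)

lemma cell_cover:
  assumes "0 \<le> x" "x < 1" "0 < n"
  obtains k where "k < n" "x \<in> cell n k"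
proof
  let ?k = "nat \<lfloor>n * x\<rfloor>"
  have *: "real ?k \<le> n * x" "n * x < real ?k + 1"
    using assms by (auto simp: of_nat_nat)
  have "n * x < n" using assms by simp
  with * have "real ?k < n" by linarith
  then show "?k < n" by simp
  show "x \<in> cell n ?k"
    using * assms by (auto simp: cell_def field_simps)
qed

lemma measure_unit_lborel:
  assumes "A \<in> sets borel" "A \<subseteq> {0..1}"
  shows "measure unit_lborel A = measure lborel A"
  using assms by (intro measure_restrict_space) auto

lemma cell_mass_bounds:
  assumes f: "f \<in> borel_measurable borel" "\<And>x. 0 \<le> f x" "\<And>x. f x \<le> 1" and k: "k < n"
  shows "0 \<le> cell_mass f n k" "cell_mass f n k \<le> 1 / n"
proof -
  note f(1)[measurable]
  show "0 \<le> cell_mass f n k"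
    unfolding cell_mass_def by (intro integral_nonneg_AE AE_I2) (auto simp: f)
  have "cell_mass f n k \<le> (LINT x|unit_lborel. indicator (cell n k) x)"
    unfolding cell_mass_def
    by (intro integral_mono integrable_unit_lborel[where B = 1]) (auto simp: f indicator_def)
  also have "\<dots> = measure unit_lborel (cell n k)"
    using cell_subset[OF k]
    by (subst Bochner_Integration.integral_indicator) (auto simp: space_unit_lborel Int_absorb2)
  also have "\<dots> = 1 / n"
    using cell_subset[OF k] k
    by (subst measure_unit_lborel) (auto simp: cell_def field_simps)
  finally show "cell_mass f n k \<le> 1 / n" .
qed

lemma bunched_set_Int_cell:
  assumes f: "f \<in> borel_measurable borel" "\<And>x. 0 \<le> f x" "\<And>x. f x \<le> 1" and k: "k < n"
  shows "bunched_set f n \<inter> cell n k = {k / n ..< k / n + cell_mass f n k}"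
proof -
  have sub: "{j / n ..< j / n + cell_mass f n j} \<subseteq> cell n j" if "j < n" for j
    using cell_mass_bounds[OF f that] by (auto simp: cell_def add_divide_distrib)
  show ?thesis
  proof (intro set_eqI iffI)
    fix x assume x: "x \<in> bunched_set f n \<inter> cell n k"
    then obtain j where "j < n" and j: "x \<in> {j / n ..< j / n + cell_mass f n j}"
      by (auto simp: bunched_set_def)
    then have "x \<in> cell n j" using sub by blast
    then have "j = k" using x cell_disjoint by blast
    with j show "x \<in> {k / n ..< k / n + cell_mass f n k}" by simp
  next
    fix x assume x: "x \<in> {k / n ..< k / n + cell_mass f n k}"
    then show "x \<in> bunched_set f n \<inter> cell n k"
      using sub[OF k] k by (auto simp: bunched_set_def)
  qed
qed

lemma bunched_set_subset:
  assumes f: "f \<in> borel_measurable borel" "\<And>x. 0 \<le> f x" "\<And>x. f x \<le> 1"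
  shows "bunched_set f n \<subseteq> {0..1}"
proof
  fix x assume "x \<in> bunched_set f n"
  then obtain j where "j < n" and j: "x \<in> {j / n ..< j / n + cell_mass f n j}"
    by (auto simp: bunched_set_def)
  then show "x \<in> {0..1}"
    using cell_subset[of j n] bunched_set_Int_cell[OF f \<open>j < n\<close>] by blast
qed

text \<open>As a consequence, the set and the weight are indistinguishable for functions that are constant on
  the cells.\<close>

lemma integral_bunched_set_cell:
  assumes f: "f \<in> borel_measurable borel" "\<And>x. 0 \<le> f x" "\<And>x. f x \<le> 1" and k: "k < n"
  shows "(LINT x|unit_lborel. indicator (cell n k) x * (indicator (bunched_set f n) x - f x)) = 0"
proof -
  note f(1)[measurable]
  let ?J = "{k / n ..< k / n + cell_mass f n k}"
  have J: "?J \<subseteq> {0..1}"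
    using bunched_set_Int_cell[OF f k] cell_subset[OF k] by blast
  have "(LINT x|unit_lborel. indicator (cell n k) x * indicator (bunched_set f n) x)
      = (LINT x|unit_lborel. indicator ?J x :: real)"
    unfolding bunched_set_Int_cell[OF f k, symmetric]
    by (intro Bochner_Integration.integral_cong) (auto simp: indicator_def)
  also have "\<dots> = measure unit_lborel ?J"
    using J by (subst Bochner_Integration.integral_indicator) (auto simp: space_unit_lborel Int_absorb2)
  also have "\<dots> = cell_mass f n k"
    using J cell_mass_bounds[OF f k] by (subst measure_unit_lborel) auto
  finally have *: "(LINT x|unit_lborel. indicator (cell n k) x * indicator (bunched_set f n) x)
    = cell_mass f n k" .
  have "(LINT x|unit_lborel. indicator (cell n k) x * (indicator (bunched_set f n) x - f x))
    = (LINT x|unit_lborel. indicator (cell n k) x * indicator (bunched_set f n) x) - cell_mass f n k"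
    unfolding cell_mass_def right_diff_distrib
    by (intro Bochner_Integration.integral_diff integrable_unit_lborel[where B = 1])
       (auto simp: f indicator_def)
  with * show ?thesis by simp
qed

text \<open>A continuous test function is uniformly close to a step function \<open>s\<close> on a fine grid of cells, and
  step functions do not tell the set from the weight.\<close>

lemma bunched_set_weak_limit_continuous:
  fixes g :: "real \<Rightarrow> real"
  assumes f: "f \<in> borel_measurable borel" "\<And>x. 0 \<le> f x" "\<And>x. f x \<le> 1"
    and g: "continuous_on UNIV g"
  shows "(\<lambda>n. LINT x|unit_lborel. (indicator (bunched_set f n) x - f x) * g x) \<longlonglongrightarrow> 0"
proof (rule tendstoI)
  fix e :: real assume "e > 0"
  note f(1)[measurable]
  have [measurable]: "g \<in> borel_measurable borel"
    using g by (rule borel_measurable_continuous_onI)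
  have "continuous_on {0..1} g" using g continuous_on_subset by blast
  then have "uniformly_continuous_on {0..1} g"
    by (rule compact_uniformly_continuous) simp
  then obtain d where "d > 0" and d: "\<And>x y. x \<in> {0..1} \<Longrightarrow> y \<in> {0..1} \<Longrightarrow> dist y x < d \<Longrightarrow> dist (g y) (g x) < e/2"
    unfolding uniformly_continuous_on_def using \<open>e > 0\<close> by (metis half_gt_zero)
  obtain B where B: "\<And>x. x \<in> {0..1} \<Longrightarrow> \<bar>g x\<bar> \<le> B"
  proof -
    have "bounded (g ` {0..1})"
      by (intro compact_imp_bounded compact_continuous_image \<open>continuous_on {0..1} g\<close>) simp
    then show thesis using that by (force simp: bounded_iff)
  qed
  have "\<forall>\<^sub>F n in sequentially. n > 0 \<and> 1 / real n < d"
    by (intro eventually_conj eventually_gt_at_top order_tendstoD(2)[OF lim_1_over_n] \<open>d > 0\<close>)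
  then show "\<forall>\<^sub>F n in sequentially.
      dist (LINT x|unit_lborel. (indicator (bunched_set f n) x - f x) * g x) 0 < e"
  proof eventually_elim
    case (elim n)
    define h where "h x = indicator (bunched_set f n) x - f x" for x
    define s where "s x = (\<Sum>k<n. g (k / n) * indicator (cell n k) x)" for x
    have [measurable]: "h \<in> borel_measurable borel" "s \<in> borel_measurable borel"
      unfolding h_def[abs_def] s_def[abs_def] by measurable
    have h1: "\<bar>h x\<bar> \<le> 1" for x
      using f(2)[of x] f(3)[of x] by (auto simp: h_def indicator_def)
    have s_eq: "s x = g (k / n)" if "k < n" "x \<in> cell n k" for x k
    proof -
      have "s x = (\<Sum>j<n. if j = k then g (k / n) else 0)"
        unfolding s_def using that cell_disjoint by (intro sum.cong) (auto simp: indicator_def)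
      then show ?thesis using that by simp
    qed
    have close: "\<bar>g x - s x\<bar> \<le> e/2" if x: "0 \<le> x" "x < 1" for x
    proof -
      obtain k where k: "k < n" "x \<in> cell n k" using cell_cover[of x n] x elim by blast
      have "x - k / n < 1 / n" "x \<ge> k / n"
        using k by (auto simp: cell_def add_divide_distrib)
      then have "dist x (k/n) < d" using elim by (auto simp: dist_real_def)
      moreover have "real k / n \<in> {0..1}" using k by (auto simp: divide_simps)
      ultimately have "dist (g x) (g (k/n)) < e/2"
        using x by (intro d) auto
      then show ?thesis unfolding s_eq[OF k] by (simp add: dist_real_def)
    qed
    \<comment> \<open>This bound depends on \<open>n\<close>; it only serves to make \<open>h x * s x\<close> integrable.\<close>
    have sB: "\<bar>s x\<bar> \<le> (\<Sum>k<n. \<bar>g (k/n)\<bar>)" for x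
      unfolding s_def by (intro order_trans[OF sum_abs] sum_mono) (auto simp: indicator_def)
    have int_s: "(LINT x|unit_lborel. h x * s x) = 0"
    proof -
      have "(LINT x|unit_lborel. h x * s x)
        = (LINT x|unit_lborel. (\<Sum>k<n. g (k/n) * (indicator (cell n k) x * h x)))"
        unfolding s_def sum_distrib_left
        by (intro Bochner_Integration.integral_cong sum.cong refl) (simp only: mult_ac)
      also have "\<dots> = (\<Sum>k<n. (LINT x|unit_lborel. g (k/n) * (indicator (cell n k) x * h x)))"
        using h1 by (intro Bochner_Integration.integral_sum integrable_mult_right integrable_unit_lborel[where B = 1])
           (auto simp: indicator_def)
      also have "\<dots> = 0"
        using integral_bunched_set_cell[OF f] by (simp add: h_def)
      finally show ?thesis .
    qed
    have i1: "integrable unit_lborel (\<lambda>x. h x * g x)"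
    proof (rule integrable_unit_lborel[where B = "1 * B"])
      show "\<bar>h x * g x\<bar> \<le> 1 * B" if "x \<in> {0..1}" for x
        unfolding abs_mult using B[OF that] h1 by (intro mult_mono) auto
    qed measurable
    have i2: "integrable unit_lborel (\<lambda>x. h x * s x)"
    proof (rule integrable_unit_lborel[where B = "1 * (\<Sum>k<n. \<bar>g (k/n)\<bar>)"])
      show "\<bar>h x * s x\<bar> \<le> 1 * (\<Sum>k<n. \<bar>g (k/n)\<bar>)" for x
        unfolding abs_mult using h1 sB by (intro mult_mono) auto
    qed measurable
    have "(LINT x|unit_lborel. h x * g x) = (LINT x|unit_lborel. h x * g x - h x * s x)"
      using Bochner_Integration.integral_diff[OF i1 i2] int_s by simp
    also have "\<bar>\<dots>\<bar> \<le> e / 2"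
    proof -
      have ae: "AE x in unit_lborel. \<bar>h x * g x - h x * s x\<bar> \<le> e / 2"
      proof -
        \<comment> \<open>The half-open cells do not reach the right end point of the unit interval.\<close>
        have "AE x in unit_lborel. x \<noteq> 1"
          by (subst AE_restrict_space_iff) (auto intro: AE_lborel_singleton AE_mp)
        then show ?thesis
        proof (rule AE_mp, intro AE_I2 impI)
          fix x assume "x \<in> space unit_lborel" "x \<noteq> 1"
          then have "\<bar>h x\<bar> * \<bar>g x - s x\<bar> \<le> 1 * (e / 2)"
            using h1 by (intro mult_mono close) (auto simp: space_unit_lborel)
          then show "\<bar>h x * g x - h x * s x\<bar> \<le> e / 2"
            by (simp add: abs_mult[symmetric] right_diff_distrib)
        qed
      qed
      have "\<bar>LINT x|unit_lborel. h x * g x - h x * s x\<bar> \<le> (LINT x|unit_lborel. \<bar>h x * g x - h x * s x\<bar>)"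
        by (rule integral_abs_bound)
      also have "\<dots> \<le> (LINT x|unit_lborel. e / 2)"
        using i1 i2 ae by (intro integral_mono_AE) auto
      also have "\<dots> = e / 2" by (simp add: unit_lborel.prob_space[unfolded space_unit_lborel] space_unit_lborel)
      finally show ?thesis .
    qed
    also have "\<dots> < e" using \<open>e > 0\<close> by simp
    finally show ?case by (simp add: h_def)
  qed
qed

text \<open>A measurable function is an almost everywhere limit of continuous functions. Truncating these to
  \<open>[-1, 1]\<close> keeps them continuous and makes dominated convergence applicable.\<close>

lemma bounded_L1_approx_continuous:
  fixes \<phi> :: "real \<Rightarrow> real"
  assumes \<phi>: "\<phi> \<in> borel_measurable borel" "\<And>x. \<bar>\<phi> x\<bar> \<le> 1" and "e > 0"
  obtains g where "continuous_on UNIV g" "\<And>x. \<bar>g x\<bar> \<le> 1" "(LINT x|unit_lborel. \<bar>\<phi> x - g x\<bar>) < e"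
proof -
  note \<phi>(1)[measurable]
  have "\<phi> \<in> borel_measurable lebesgue" by (simp add: measurable_completion)
  then have "\<phi> measurable_on UNIV"
    by (intro lebesgue_measurable_imp_measurable_on) (auto)
  then obtain N G where N: "negligible N" and G: "\<And>n. continuous_on UNIV (G n)"
    and lim: "\<And>x. x \<notin> N \<Longrightarrow> (\<lambda>n. G n x) \<longlonglongrightarrow> \<phi> x"
    unfolding measurable_on_def by auto
  define g where "g n x = max (-1) (min 1 (G n x))" for n x
  have g: "continuous_on UNIV (g n)" for n
    unfolding g_def[abs_def] by (intro continuous_intros G)
  then have [measurable]: "g n \<in> borel_measurable borel" for n
    by (rule borel_measurable_continuous_onI)
  have g1: "\<bar>g n x\<bar> \<le> 1" for n x by (auto simp: g_def)
  have lim': "(\<lambda>n. \<bar>\<phi> x - g n x\<bar>) \<longlonglongrightarrow> 0" if "x \<notin> N" for x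
  proof -
    have "(\<lambda>n. \<bar>\<phi> x - g n x\<bar>) \<longlonglongrightarrow> \<bar>\<phi> x - max (-1) (min 1 (\<phi> x))\<bar>"
      unfolding g_def by (intro tendsto_intros lim that)
    moreover have "max (-1) (min 1 (\<phi> x)) = \<phi> x" using \<phi>(2)[of x] by auto
    ultimately show ?thesis by simp
  qed
  have "AE x in lebesgue. x \<notin> N"
    using N by (simp add: negligible_iff_null_sets AE_not_in)
  then have "AE x in lborel. x \<notin> N" by (simp add: AE_completion_iff)
  then have "AE x in unit_lborel. x \<notin> N"
    by (subst AE_restrict_space_iff) auto
  then have ae: "AE x in unit_lborel. (\<lambda>n. \<bar>\<phi> x - g n x\<bar>) \<longlonglongrightarrow> 0"
    by (rule AE_mp) (auto intro!: AE_I2 lim')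
  have "(\<lambda>n. LINT x|unit_lborel. \<bar>\<phi> x - g n x\<bar>) \<longlonglongrightarrow> (LINT x|unit_lborel. 0)"
  proof (rule integral_dominated_convergence[where w = "\<lambda>_. 2"])
    show "AE x in unit_lborel. norm \<bar>\<phi> x - g n x\<bar> \<le> 2" for n
    proof (intro AE_I2)
      fix x show "norm \<bar>\<phi> x - g n x\<bar> \<le> 2" using \<phi>(2)[of x] g1[of n x] by (simp)
    qed
  qed (use ae in auto)
  then have "\<forall>\<^sub>F n in sequentially. (LINT x|unit_lborel. \<bar>\<phi> x - g n x\<bar>) < e"
    using \<open>e > 0\<close> by (auto intro: order_tendstoD)
  then obtain n where "(LINT x|unit_lborel. \<bar>\<phi> x - g n x\<bar>) < e"
    using eventually_happens'[OF sequentially_bot] by blast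
  then show thesis using that g g1 by blast
qed

text \<open>Since the set and the weight differ by at most 1 everywhere, an approximation of the test function
  in mean costs no more than its own error, uniformly in \<open>n\<close>.\<close>

lemma bunched_set_weak_limit:
  fixes \<phi> :: "real \<Rightarrow> real"
  assumes f: "f \<in> borel_measurable borel" "\<And>x. 0 \<le> f x" "\<And>x. f x \<le> 1"
    and \<phi>: "\<phi> \<in> borel_measurable borel" "\<And>x. \<bar>\<phi> x\<bar> \<le> 1"
  shows "(\<lambda>n. LINT x|unit_lborel. indicator (bunched_set f n) x * \<phi> x)
      \<longlonglongrightarrow> (LINT x|unit_lborel. f x * \<phi> x)"
proof -
  note f(1)[measurable] \<phi>(1)[measurable]
  define h where "h n x = indicator (bunched_set f n) x - f x" for n x
  have [measurable]: "h n \<in> borel_measurable borel" for n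
    unfolding h_def[abs_def] by measurable
  have h1: "\<bar>h n x\<bar> \<le> 1" for n x
    using f(2)[of x] f(3)[of x] by (auto simp: h_def indicator_def)
  have "(\<lambda>n. LINT x|unit_lborel. h n x * \<phi> x) \<longlonglongrightarrow> 0"
  proof (rule tendstoI)
    fix e :: real assume "e > 0"
    obtain g where g: "continuous_on UNIV g" "\<And>x. \<bar>g x\<bar> \<le> 1" "(LINT x|unit_lborel. \<bar>\<phi> x - g x\<bar>) < e/2"
      using bounded_L1_approx_continuous[OF \<phi>, of "e/2"] \<open>e > 0\<close> by auto
    have [measurable]: "g \<in> borel_measurable borel"
      using g(1) by (rule borel_measurable_continuous_onI)
    have "\<forall>\<^sub>F n in sequentially. dist (LINT x|unit_lborel. h n x * g x) 0 < e/2"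
      unfolding h_def using bunched_set_weak_limit_continuous[OF f g(1)] \<open>e > 0\<close>
      by (intro tendstoD) auto
    then show "\<forall>\<^sub>F n in sequentially. dist (LINT x|unit_lborel. h n x * \<phi> x) 0 < e"
    proof eventually_elim
      case (elim n)
      have b: "\<bar>h n x * u\<bar> \<le> 1" if "\<bar>u\<bar> \<le> 1" for x u
        using mult_mono[OF h1[of n x] that] by (simp add: abs_mult)
      have i: "integrable unit_lborel (\<lambda>x. h n x * g x)" "integrable unit_lborel (\<lambda>x. h n x * \<phi> x)"
        by (auto intro!: integrable_unit_lborel[where B = 1] b g \<phi>)
      have i3: "integrable unit_lborel (\<lambda>x. \<phi> x - g x)"
        by (intro Bochner_Integration.integrable_diff integrable_unit_lborel[where B = 1])
           (auto intro!: \<phi> g)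
      have "(LINT x|unit_lborel. h n x * \<phi> x) - (LINT x|unit_lborel. h n x * g x)
          = (LINT x|unit_lborel. h n x * \<phi> x - h n x * g x)"
        using i by simp
      also have "\<bar>\<dots>\<bar> \<le> (LINT x|unit_lborel. \<bar>h n x * \<phi> x - h n x * g x\<bar>)"
        by (rule integral_abs_bound)
      also have "\<dots> \<le> (LINT x|unit_lborel. \<bar>\<phi> x - g x\<bar>)"
      proof (intro integral_mono)
        show "\<bar>h n x * \<phi> x - h n x * g x\<bar> \<le> \<bar>\<phi> x - g x\<bar>" for x
          using mult_right_mono[OF h1[of n x], of "\<bar>\<phi> x - g x\<bar>"]
          by (simp add: abs_mult[symmetric] right_diff_distrib)
      qed (use i i3 in auto)
      finally show ?case using g(3) elim by (auto simp: dist_real_def)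
    qed
  qed
  then have "(\<lambda>n. (LINT x|unit_lborel. h n x * \<phi> x) + (LINT x|unit_lborel. f x * \<phi> x))
      \<longlonglongrightarrow> 0 + (LINT x|unit_lborel. f x * \<phi> x)"
    by (intro tendsto_intros)
  moreover have "(LINT x|unit_lborel. h n x * \<phi> x) + (LINT x|unit_lborel. f x * \<phi> x)
      = (LINT x|unit_lborel. indicator (bunched_set f n) x * \<phi> x)" for n
  proof -
    have b: "\<bar>u * \<phi> x\<bar> \<le> 1" if "\<bar>u\<bar> \<le> 1" for x u
      using mult_mono[OF that \<phi>(2)[of x]] by (simp add: abs_mult)
    have "integrable unit_lborel (\<lambda>x. h n x * \<phi> x)" "integrable unit_lborel (\<lambda>x. f x * \<phi> x)"
      using f by (auto intro!: integrable_unit_lborel[where B = 1] b h1)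
    from Bochner_Integration.integral_add[OF this, symmetric] show ?thesis
      by (simp add: h_def algebra_simps)
  qed
  ultimately show ?thesis by simp
qed

section \<open>Borel graphons and weighted local density\<close>

text \<open>Symmetry and the bounds are required on the whole plane, so that no side conditions on points
  arise.\<close>

locale borel_graphon =
  fixes U :: "real \<Rightarrow> real \<Rightarrow> real"
  assumes measurable_kernel: "(\<lambda>z. U (fst z) (snd z)) \<in> borel_measurable borel"
    and sym: "U x y = U y x" and nonneg: "0 \<le> U x y" and le_one: "U x y \<le> 1"
begin

lemma measurable_U [measurable (raw)]:
  assumes [measurable]: "f \<in> borel_measurable N" "g \<in> borel_measurable N"
  shows "(\<lambda>x. U (f x) (g x)) \<in> borel_measurable N"
proof -
  have "(\<lambda>x. (f x, g x)) \<in> N \<rightarrow>\<^sub>M borel" unfolding borel_prod[symmetric] by measurable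
  from measurable_compose[OF this measurable_kernel] show ?thesis by simp
qed

lemma edge_weight_eq: "edge_weight U x {i, j} = U (x i) (x j)"
  unfolding edge_weight_def using sym by (intro the_equality) (auto simp: doubleton_eq_iff)

lemma edge_weight_bounds:
  assumes "card e = 2"
  shows "0 \<le> edge_weight U x e" "edge_weight U x e \<le> 1"
  using assms nonneg le_one by (auto simp: card_2_iff edge_weight_eq)

lemma edge_weight_image:
  assumes "card e = 2"
  shows "edge_weight U x (h ` e) = edge_weight U (\<lambda>v. x (h v)) e"
  using assms by (auto simp: card_2_iff edge_weight_eq)

lemma edge_weight_cong:
  assumes "card e = 2" "\<And>v. v \<in> e \<Longrightarrow> x v = y v"
  shows "edge_weight U x e = edge_weight U y e"
  using assms by (auto simp: card_2_iff edge_weight_eq)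

end

text \<open>Local density is asked for Borel sets only; the sets \<open>bunched_set f n\<close> are finite unions of
  intervals.\<close>

locale dense_borel_graphon = borel_graphon +
  fixes \<rho> :: real
  assumes rho_nonneg: "0 \<le> \<rho>"
    and dense: "\<And>S. S \<in> sets borel \<Longrightarrow> S \<subseteq> {0..1} \<Longrightarrow>
      \<rho> * (measure unit_lborel S)\<^sup>2
        \<le> (LINT x|unit_lborel. LINT y|unit_lborel. indicator S x * indicator S y * U x y)"
begin

text \<open>The quadratic form of \<open>U\<close> is continuous along the weakly convergent sets \<open>S n\<close>: integration
  against \<open>U\<close> in one variable turns weak convergence into pointwise convergence of \<open>a n\<close> to \<open>b\<close>,
  and the product of a bounded weakly convergent and a bounded pointwise convergent sequence
  converges weakly.\<close>

lemma weighted_dense: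
  assumes f: "f \<in> borel_measurable borel" "\<And>x. 0 \<le> f x" "\<And>x. f x \<le> 1"
  shows "\<rho> * (LINT x|unit_lborel. f x)\<^sup>2
     \<le> (LINT x|unit_lborel. f x * (LINT y|unit_lborel. f y * U x y))"
proof -
  note f(1)[measurable]
  define S where "S = bunched_set f"
  have [measurable]: "S n \<in> sets borel" for n by (simp add: S_def)
  define a where "a n x = (LINT y|unit_lborel. indicator (S n) y * U x y)" for n x
  define b where "b x = (LINT y|unit_lborel. f y * U x y)" for x
  have [measurable]: "a n \<in> borel_measurable borel" for n
    unfolding a_def[abs_def] by measurable
  have [measurable]: "b \<in> borel_measurable borel"
    unfolding b_def[abs_def] by measurable
  have lim_a: "(\<lambda>n. a n x) \<longlonglongrightarrow> b x" for x
    unfolding a_def b_def S_def using f nonneg le_one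
    by (intro bunched_set_weak_limit) auto
  have bound: "0 \<le> (LINT y|unit_lborel. g y * U x y)" "(LINT y|unit_lborel. g y * U x y) \<le> 1"
    if [measurable]: "g \<in> borel_measurable borel" and g: "\<And>y. 0 \<le> g y" "\<And>y. g y \<le> 1" for g x
  proof -
    show "0 \<le> (LINT y|unit_lborel. g y * U x y)"
      by (intro integral_nonneg_AE AE_I2) (auto simp: g nonneg)
    show "(LINT y|unit_lborel. g y * U x y) \<le> 1"
      by (intro unit_lborel.integral_le_const integrable_unit_lborel[where B = 1] AE_I2)
         (auto simp: g nonneg le_one abs_mult mult_le_one)
  qed
  have a01: "0 \<le> a n x" "a n x \<le> 1" and b01: "0 \<le> b x" "b x \<le> 1" for n x
    unfolding a_def b_def using f by (auto intro!: bound)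
  have lim1: "(\<lambda>n. LINT x|unit_lborel. indicator (S n) x * b x) \<longlonglongrightarrow> (LINT x|unit_lborel. f x * b x)"
    unfolding S_def using b01 by (intro bunched_set_weak_limit f) auto
  have "(\<lambda>n. LINT x|unit_lborel. indicator (S n) x * (a n x - b x)) \<longlonglongrightarrow> (LINT x|unit_lborel. 0)"
  proof (rule integral_dominated_convergence[where w = "\<lambda>_. 1"])
    show "AE x in unit_lborel. (\<lambda>n. indicator (S n) x * (a n x - b x)) \<longlonglongrightarrow> 0"
    proof (intro AE_I2)
      fix x
      have "(\<lambda>n. a n x - b x) \<longlonglongrightarrow> 0" using lim_a by (simp add: LIM_zero_iff)
      then show "(\<lambda>n. indicator (S n) x * (a n x - b x)) \<longlonglongrightarrow> 0"
        by (rule Lim_null_comparison[rotated, OF tendsto_norm_zero])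
           (auto simp: indicator_def)
    qed
    show "AE x in unit_lborel. norm (indicator (S n) x * (a n x - b x)) \<le> 1" for n
    proof (intro AE_I2)
      fix x show "norm (indicator (S n) x * (a n x - b x)) \<le> 1"
        using a01[of n x] b01[of x] by (auto simp: indicator_def)
    qed
  qed auto
  from tendsto_add[OF this lim1]
  have "(\<lambda>n. (LINT x|unit_lborel. indicator (S n) x * (a n x - b x))
      + (LINT x|unit_lborel. indicator (S n) x * b x)) \<longlonglongrightarrow> (LINT x|unit_lborel. f x * b x)" by simp
  moreover have "(LINT x|unit_lborel. indicator (S n) x * (a n x - b x))
      + (LINT x|unit_lborel. indicator (S n) x * b x) = (LINT x|unit_lborel. indicator (S n) x * a n x)" for n
  proof -
    have "\<bar>a n x - b x\<bar> \<le> 1" "\<bar>b x\<bar> \<le> 1" for x using a01[of n x] b01[of x] by auto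
    then have "integrable unit_lborel (\<lambda>x. indicator (S n) x * (a n x - b x))"
      "integrable unit_lborel (\<lambda>x. indicator (S n) x * b x)"
      by (auto intro!: integrable_unit_lborel[where B = 1] simp: indicator_def)
    from Bochner_Integration.integral_add[OF this, symmetric] show ?thesis
      by (simp add: algebra_simps)
  qed
  ultimately have lim2: "(\<lambda>n. LINT x|unit_lborel. indicator (S n) x * a n x) \<longlonglongrightarrow> (LINT x|unit_lborel. f x * b x)"
    by simp
  have "(\<lambda>n. LINT x|unit_lborel. indicator (S n) x * 1) \<longlonglongrightarrow> (LINT x|unit_lborel. f x * 1)"
    unfolding S_def by (intro bunched_set_weak_limit f) auto
  moreover have "(LINT x|unit_lborel. indicator (S n) x * 1) = measure unit_lborel (S n)" for n
    using bunched_set_subset[OF f, of n]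
    by (simp add: Bochner_Integration.integral_indicator space_unit_lborel Int_absorb2 S_def)
  ultimately have "(\<lambda>n. \<rho> * (measure unit_lborel (S n))\<^sup>2) \<longlonglongrightarrow> \<rho> * (LINT x|unit_lborel. f x)\<^sup>2"
    by (intro tendsto_intros) simp
  moreover have "\<rho> * (measure unit_lborel (S n))\<^sup>2 \<le> (LINT x|unit_lborel. indicator (S n) x * a n x)" for n
  proof -
    have "(LINT x|unit_lborel. LINT y|unit_lborel. indicator (S n) x * indicator (S n) y * U x y)
      = (LINT x|unit_lborel. indicator (S n) x * a n x)"
      unfolding a_def by (simp add: mult.assoc)
    then show ?thesis using dense[of "S n"] bunched_set_subset[OF f, of n] by (simp add: S_def)
  qed
  ultimately show ?thesis using lim2 unfolding b_def
    by (intro LIMSEQ_le) auto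
qed

end

section \<open>Densities of complete graphs\<close>

definition clique_edges :: "'a set \<Rightarrow> 'a set set" where
  "clique_edges V = {e. e \<subseteq> V \<and> card e = 2}"

abbreviation unit_cube :: "'a set \<Rightarrow> ('a \<Rightarrow> real) measure" where
  "unit_cube V \<equiv> Pi\<^sub>M V (\<lambda>_. unit_lborel)"

lemma prob_space_unit_cube: "prob_space (unit_cube V)"
  by (intro prob_space_PiM prob_space_unit_lborel)

lemma product_prob_space_unit_lborel: "product_prob_space (\<lambda>_. unit_lborel)"
  by (intro product_prob_spaceI prob_space_unit_lborel)

lemma integrable_unit_cube:
  fixes f :: "('a \<Rightarrow> real) \<Rightarrow> real"
  assumes "f \<in> borel_measurable (unit_cube V)" "\<And>x. \<bar>f x\<bar> \<le> B"
  shows "integrable (unit_cube V) f"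
proof -
  interpret prob_space "unit_cube V" by (rule prob_space_unit_cube)
  show ?thesis using assms by (intro integrable_const_bound[of _ B] AE_I2) auto
qed

lemma measurable_unit_cube_component [measurable (raw)]:
  assumes "v \<in> V"
  shows "(\<lambda>x. x v) \<in> borel_measurable (unit_cube V)"
  using measurable_compose[OF measurable_component_singleton[OF assms] measurable_unit_lborel[OF measurable_ident]]
  by simp

lemma finite_clique_edges: "finite V \<Longrightarrow> finite (clique_edges V)"
  unfolding clique_edges_def by (rule finite_subset[of _ "Pow V"]) auto

lemma card_clique_edges: "finite V \<Longrightarrow> card (clique_edges V) = card V choose 2"
  unfolding clique_edges_def by (rule n_subsets)

lemma clique_edges_insert:
  assumes "a \<notin> V"
  shows "clique_edges (insert a V) = clique_edges V \<union> (\<lambda>v. {a, v}) ` V"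
    and "clique_edges V \<inter> (\<lambda>v. {a, v}) ` V = {}"
  using assms by (auto simp: clique_edges_def card_2_iff)

text \<open>The graph of a power lies above its tangent at \<open>c\<close>. Integrated against a weight, this is Jensen's
  inequality without a division by the mass of the weight, which may be zero.\<close>

lemma power_tangent_le:
  fixes c g :: real
  assumes "0 \<le> c" "0 \<le> g"
  shows "c ^ n + real n * c ^ (n - 1) * (g - c) \<le> g ^ n"
proof (induction n)
  case (Suc n)
  have "c ^ Suc n + real (Suc n) * c ^ n * (g - c) \<le> g * (c ^ n + real n * c ^ (n - 1) * (g - c))"
  proof (cases n)
    case (Suc m)
    have "g * (c ^ n + real n * c ^ (n - 1) * (g - c)) - (c ^ Suc n + real (Suc n) * c ^ n * (g - c))
      = real n * c ^ m * (g - c)\<^sup>2"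
      using Suc by (simp add: power2_eq_square algebra_simps)
    moreover have "\<dots> \<ge> 0" using assms by simp
    ultimately show ?thesis by linarith
  qed simp
  also have "\<dots> \<le> g * g ^ n" using Suc.IH assms by (intro mult_left_mono)
  finally show ?case by simp
qed simp

context borel_graphon
begin

lemma measurable_edge_weight [measurable (raw)]:
  assumes "e \<subseteq> V" "card e = 2"
  shows "(\<lambda>x. edge_weight U x e) \<in> borel_measurable (unit_cube V)"
proof -
  obtain i j where e: "e = {i, j}" using assms(2) by (auto simp: card_2_iff)
  then have "i \<in> V" "j \<in> V" using assms by auto
  then show ?thesis unfolding e edge_weight_eq by measurable
qed

end

context dense_borel_graphon
begin

text \<open>The weight has to vary in the induction: fixing the new vertex at \<open>y\<close> multiplies the weight of each
  remaining vertex by \<open>U y\<close>.\<close>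

lemma weighted_clique_density:
  assumes "finite V"
    and f: "f \<in> borel_measurable borel" "\<And>x. 0 \<le> f x" "\<And>x. f x \<le> 1"
  shows "\<rho> ^ (card V choose 2) * (LINT t|unit_lborel. f t) ^ card V
     \<le> (LINT x|unit_cube V. (\<Prod>v\<in>V. f (x v)) * (\<Prod>e\<in>clique_edges V. edge_weight U x e))"
  using assms
proof (induction V arbitrary: f rule: finite_induct)
  case empty
  have "clique_edges ({} :: 'a set) = {}" by (auto simp: clique_edges_def)
  then show ?case
    by (simp add: PiM_empty lebesgue_integral_count_space_finite binomial_eq_0)
next
  case (insert a V)
  note f = insert.prems and [measurable] = insert.prems(1)
  interpret product_prob_space "\<lambda>_. unit_lborel" by (rule product_prob_space_unit_lborel)
  interpret cube: prob_space "unit_cube V" by (rule prob_space_unit_cube)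
  interpret pair: pair_sigma_finite "unit_cube V" unit_lborel ..
  define n where "n = card V"
  define C where "C = \<rho> ^ (n choose 2)"
  define F where "F x = (\<Prod>v\<in>V. f (x v)) * (\<Prod>e\<in>clique_edges V. edge_weight U x e)" for x
  define G where "G y x = (\<Prod>v\<in>V. f (x v) * U y (x v)) * (\<Prod>e\<in>clique_edges V. edge_weight U x e)" for y x
  let ?L = "\<lambda>x. (\<Prod>v\<in>insert a V. f (x v)) * (\<Prod>e\<in>clique_edges (insert a V). edge_weight U x e)"
  have split: "?L (x(a := y)) = f y * G y x" for x y
  proof -
    have "(\<Prod>v\<in>insert a V. f ((x(a := y)) v)) = f y * (\<Prod>v\<in>V. f (x v))"
    proof -
      have "(\<Prod>v\<in>V. f ((x(a := y)) v)) = (\<Prod>v\<in>V. f (x v))"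
        using insert.hyps by (intro prod.cong) auto
      then show ?thesis using insert.hyps by simp
    qed
    moreover have "(\<Prod>e\<in>clique_edges (insert a V). edge_weight U (x(a := y)) e)
      = (\<Prod>e\<in>clique_edges V. edge_weight U (x(a := y)) e)
        * (\<Prod>e\<in>(\<lambda>v. {a, v}) ` V. edge_weight U (x(a := y)) e)"
      using insert.hyps clique_edges_insert[OF insert.hyps(2)]
      by (simp add: prod.union_disjoint finite_clique_edges)
    moreover have "(\<Prod>e\<in>clique_edges V. edge_weight U (x(a := y)) e) = (\<Prod>e\<in>clique_edges V. edge_weight U x e)"
      using insert.hyps by (intro prod.cong edge_weight_cong) (auto simp: clique_edges_def)
    moreover have "(\<Prod>e\<in>(\<lambda>v. {a, v}) ` V. edge_weight U (x(a := y)) e) = (\<Prod>v\<in>V. U y (x v))"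
    proof -
      have "inj_on (\<lambda>v. {a, v}) V" by (auto simp: inj_on_def doubleton_eq_iff)
      then have "(\<Prod>e\<in>(\<lambda>v. {a, v}) ` V. edge_weight U (x(a := y)) e) = (\<Prod>v\<in>V. edge_weight U (x(a := y)) {a, v})"
        by (simp add: prod.reindex)
      also have "\<dots> = (\<Prod>v\<in>V. U y (x v))"
        using insert.hyps by (intro prod.cong) (auto simp: edge_weight_eq)
      finally show ?thesis .
    qed
    ultimately show ?thesis by (simp add: G_def prod.distrib mult_ac)
  qed
  have cl: "e \<subseteq> W" "card e = 2" if "e \<in> clique_edges W" for e and W :: "'a set"
    using that by (auto simp: clique_edges_def)
  have L01: "0 \<le> ?L x" "?L x \<le> 1" for x
    using f cl(2)[of _ "insert a V"] by (auto intro!: mult_nonneg_nonneg prod_nonneg mult_le_one prod_le_1 edge_weight_bounds)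
  have Lm: "?L \<in> borel_measurable (unit_cube (insert a V))"
    using cl[of _ "insert a V"]
    by (intro borel_measurable_times borel_measurable_prod measurable_edge_weight
        measurable_compose[OF measurable_unit_cube_component f(1)])
  have G01: "0 \<le> G y x" "G y x \<le> 1" for y x
    unfolding G_def using f cl(2)[of _ V] nonneg le_one
    by (auto intro!: mult_nonneg_nonneg prod_nonneg mult_le_one prod_le_1 edge_weight_bounds)
  have [measurable]: "(\<lambda>z. edge_weight U (fst z) e) \<in> borel_measurable (unit_cube V \<Otimes>\<^sub>M unit_lborel)"
    if "e \<in> clique_edges V" for e
    using measurable_compose[OF measurable_fst measurable_edge_weight[OF cl[OF that]]] .
  have [measurable]: "(\<lambda>z. fst z v) \<in> borel_measurable (unit_cube V \<Otimes>\<^sub>M unit_lborel)" if "v \<in> V" for v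
    using measurable_compose[OF measurable_fst measurable_unit_cube_component[OF that]] .
  have [measurable]: "snd \<in> borel_measurable (unit_cube V \<Otimes>\<^sub>M unit_lborel)"
    using measurable_compose[OF measurable_snd measurable_unit_lborel[OF measurable_ident]] by simp
  have Gm: "(\<lambda>z. f (snd z) * G (snd z) (fst z)) \<in> borel_measurable (unit_cube V \<Otimes>\<^sub>M unit_lborel)"
    unfolding G_def by measurable
  have int_G: "integrable (unit_cube V \<Otimes>\<^sub>M unit_lborel) (\<lambda>(x, y). f y * G y x)"
  proof -
    interpret prod: prob_space "unit_cube V \<Otimes>\<^sub>M unit_lborel"
      by (rule prob_space_pair) unfold_locales
    show ?thesis
      unfolding case_prod_unfold using f G01
      by (intro prod.integrable_const_bound[of _ 1] AE_I2 Gm) (auto simp: abs_mult mult_le_one)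
  qed
  define g where "g y = (LINT t|unit_lborel. f t * U y t)" for y
  have [measurable]: "g \<in> borel_measurable borel" unfolding g_def[abs_def] by measurable
  have g01: "0 \<le> g y" "g y \<le> 1" for y
    unfolding g_def using f nonneg le_one
    by (auto intro!: integral_nonneg_AE AE_I2 unit_lborel.integral_le_const integrable_unit_lborel[where B=1]
        simp: abs_mult mult_le_one)
  \<comment> \<open>The tangent is taken at the value which \<open>weighted_dense\<close> guarantees for the mean of \<open>g\<close> with
    respect to \<open>f\<close>, so that the linear term contributes a nonnegative amount.\<close>
  define c where "c = \<rho> * (LINT t|unit_lborel. f t)"
  have c0: "0 \<le> c" unfolding c_def using rho_nonneg f by (auto intro!: mult_nonneg_nonneg integral_nonneg_AE)
  have int_f: "integrable unit_lborel f" using f by (intro integrable_unit_lborel[where B=1]) auto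
  have int_fg: "integrable unit_lborel (\<lambda>y. f y * g y)"
    using f g01 by (intro integrable_unit_lborel[where B=1]) (auto simp: abs_mult mult_le_one)
  have int_fgn: "integrable unit_lborel (\<lambda>y. f y * g y ^ n)"
    using f g01 by (intro integrable_unit_lborel[where B=1]) (auto simp: abs_mult power_abs mult_le_one power_le_one)
  have jensen: "c ^ n * (LINT y|unit_lborel. f y) \<le> (LINT y|unit_lborel. f y * g y ^ n)"
  proof -
    have "c * (LINT y|unit_lborel. f y) \<le> (LINT y|unit_lborel. f y * g y)"
      using weighted_dense[OF f] by (simp add: c_def g_def power2_eq_square mult_ac)
    then have "0 \<le> real n * c ^ (n - 1) * ((LINT y|unit_lborel. f y * g y) - c * (LINT y|unit_lborel. f y))"
      using c0 by simp
    then have "c ^ n * (LINT y|unit_lborel. f y)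
       \<le> c ^ n * (LINT y|unit_lborel. f y)
         + real n * c ^ (n - 1) * ((LINT y|unit_lborel. f y * g y) - c * (LINT y|unit_lborel. f y))"
      by simp
    also have "\<dots> = (LINT y|unit_lborel. c ^ n * f y + real n * c ^ (n - 1) * (f y * g y - c * f y))"
      using int_f int_fg by simp
    also have "\<dots> \<le> (LINT y|unit_lborel. f y * g y ^ n)"
    proof (intro integral_mono)
      fix y
      have "f y * (c ^ n + real n * c ^ (n - 1) * (g y - c)) \<le> f y * g y ^ n"
        by (intro mult_left_mono power_tangent_le f c0 g01)
      then show "c ^ n * f y + real n * c ^ (n - 1) * (f y * g y - c * f y) \<le> f y * g y ^ n"
        by (simp add: algebra_simps)
    qed (use int_f int_fg int_fgn in auto)
    finally show ?thesis .
  qed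
  have inner: "C * g y ^ n \<le> (LINT x|unit_cube V. G y x)" for y
    unfolding C_def n_def g_def G_def
    using f nonneg le_one by (intro insert.IH) (auto intro: mult_le_one)
  have C0: "0 \<le> C" using rho_nonneg by (simp add: C_def)
  have "\<rho> ^ (card (insert a V) choose 2) * (LINT t|unit_lborel. f t) ^ card (insert a V)
      = C * (c ^ n * (LINT y|unit_lborel. f y))"
  proof -
    have "card (insert a V) = Suc n" using insert.hyps by (simp add: n_def)
    moreover have "Suc n choose 2 = (n choose 2) + n" by (simp add: numeral_2_eq_2)
    ultimately show ?thesis by (simp add: C_def c_def power_add power_mult_distrib)
  qed
  also have "\<dots> \<le> C * (LINT y|unit_lborel. f y * g y ^ n)"
    using jensen C0 by (rule mult_left_mono)
  also have "\<dots> = (LINT y|unit_lborel. f y * (C * g y ^ n))"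
    by (simp add: mult_ac flip: integral_mult_right_zero)
  also have "\<dots> \<le> (LINT y|unit_lborel. f y * (LINT x|unit_cube V. G y x))"
  proof (intro integral_mono mult_left_mono inner f)
    show "integrable unit_lborel (\<lambda>y. f y * (C * g y ^ n))"
      using int_fgn by (simp add: mult.left_commute)
    show "integrable unit_lborel (\<lambda>y. f y * (LINT x|unit_cube V. G y x))"
      using pair.integrable_snd[OF int_G] by simp
  qed
  also have "\<dots> = (LINT y|unit_lborel. LINT x|unit_cube V. f y * G y x)" by simp
  also have "\<dots> = (LINT x|unit_cube V. LINT y|unit_lborel. f y * G y x)"
    by (rule pair.Fubini_integral[OF int_G])
  also have "\<dots> = (LINT x|unit_cube (insert a V). ?L x)"
    using L01 Lm insert.hyps
    by (subst product_integral_insert)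
       (auto simp: split[symmetric] intro!: integrable_unit_cube[where B = 1])
  finally show ?case .
qed

lemma clique_density:
  assumes "finite V"
  shows "\<rho> ^ (card V choose 2) \<le> (LINT x|unit_cube V. (\<Prod>e\<in>clique_edges V. edge_weight U x e))"
  using weighted_clique_density[OF assms, of "\<lambda>_. 1"]
  by (simp add: unit_lborel.prob_space[unfolded space_unit_lborel] space_unit_lborel)

end

section \<open>Borel versions of Lebesgue measurable graphons\<close>

lemma integral_completion_cong_AE:
  fixes f g :: "'a \<Rightarrow> real"
  assumes g[measurable]: "g \<in> borel_measurable M" and ae: "AE x in M. f x = g x"
  shows "integral\<^sup>L (completion M) f = integral\<^sup>L M g"
proof -
  have g': "g \<in> borel_measurable (completion M)" using g by (rule measurable_completion)
  have ae': "AE x in completion M. f x = g x" using ae by (rule AE_completion)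
  have f': "f \<in> borel_measurable (completion M)"
  proof (rule measurableI)
    fix A :: "real set" assume "A \<in> sets borel"
    then have "g -` A \<inter> space (completion M) \<in> sets (completion M)"
      using g' by (rule measurable_sets[rotated])
    moreover have "AE x in completion M.
        x \<in> g -` A \<inter> space (completion M) \<longleftrightarrow> x \<in> f -` A \<inter> space (completion M)"
      using ae' by (rule eventually_mono) simp
    ultimately show "f -` A \<inter> space (completion M) \<in> sets (completion M)"
      using completion.in_sets_AE by blast
  qed simp
  have "integral\<^sup>L (completion M) f = integral\<^sup>L (completion M) g"
    using f' g' ae' by (rule integral_cong_AE)
  then show ?thesis by (simp add: integral_completion)
qed

lemma distr_swap_lborel:
  "distr lborel lborel (\<lambda>z. (snd z, fst z)) = (lborel :: (real \<times> real) measure)"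
  using lborel_pair.distr_pair_swap[where 'a=real and 'b=real]
  by (simp add: lborel_prod case_prod_unfold)

text \<open>Averaging a Borel version with its mirror image and truncating to \<open>[0, 1]\<close> enforces symmetry and the
  bounds everywhere; where \<open>W\<close> is already symmetric and bounded, nothing changes.\<close>

lemma graphon_borel_version:
  assumes W: "graphon W"
  obtains U where "borel_graphon U"
    "AE z in lborel. z \<in> {0..1} \<times> {0..1} \<longrightarrow> U (fst z) (snd z) = W (fst z) (snd z)"
proof -
  have swap: "(\<lambda>z. (snd z, fst z)) \<in> borel \<rightarrow>\<^sub>M (borel :: (real \<times> real) measure)"
    by (intro borel_measurable_continuous_onI continuous_intros)
  define sq :: "(real \<times> real) set" where "sq = {0..1} \<times> {0..1}"
  have sq: "sq \<in> sets borel" unfolding sq_def by (intro borel_closed closed_Times) auto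
  define F where "F z = indicator sq z *\<^sub>R W (fst z) (snd z)" for z
  have "F \<in> borel_measurable lebesgue"
    using W sq unfolding F_def graphon_def sq_def[symmetric]
    by (subst borel_measurable_restrict_space_iff[symmetric]) auto
  then obtain G where [measurable]: "G \<in> borel_measurable lborel" and FG: "AE z in lborel. F z = G z"
    using completion_ex_borel_measurable_real by blast
  have "AE z in lborel. F (snd z, fst z) = G (snd z, fst z)"
  proof (rule AE_distrD[where P = "\<lambda>z. F z = G z" and M' = lborel])
    show "(\<lambda>z. (snd z, fst z)) \<in> lborel \<rightarrow>\<^sub>M (lborel :: (real \<times> real) measure)"
      using swap by simp
    show "AE z in distr lborel lborel (\<lambda>z. (snd z, fst z)). F z = G z"
      unfolding distr_swap_lborel by (rule FG)
  qed
  define U where "U x y = max 0 (min 1 ((G (x, y) + G (y, x)) / 2))" for x y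
  have "borel_graphon U"
  proof
    have "(\<lambda>z. max 0 (min 1 ((G z + G (snd z, fst z)) / 2))) \<in> borel_measurable borel"
      using measurable_compose[OF swap, of G borel] by measurable
    then show "(\<lambda>z. U (fst z) (snd z)) \<in> borel_measurable borel"
      by (simp add: U_def)
  qed (auto simp: U_def add.commute)
  moreover have "AE z in lborel. z \<in> {0..1} \<times> {0..1} \<longrightarrow> U (fst z) (snd z) = W (fst z) (snd z)"
    using FG \<open>AE z in lborel. F (snd z, fst z) = G (snd z, fst z)\<close>
  proof eventually_elim
    case (elim z)
    show ?case
    proof
      assume z: "z \<in> {0..1} \<times> {0..1}"
      obtain x y where xy: "z = (x, y)" by (cases z)
      have "G (x, y) = W x y" "G (y, x) = W y x"
        using elim z by (auto simp: F_def sq_def xy)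
      moreover have "W y x = W x y" "0 \<le> W x y" "W x y \<le> 1"
        using W z by (auto simp: graphon_def xy)
      ultimately show "U (fst z) (snd z) = W (fst z) (snd z)"
        by (simp add: U_def xy)
    qed
  qed
  ultimately show thesis by (rule that)
qed

lemma AE_unit_lborelI: "AE x in lborel. P x \<Longrightarrow> AE x in unit_lborel. P x"
  by (subst AE_restrict_space_iff) (simp, erule eventually_mono, simp)

lemma AE_unit_square:
  fixes P :: "real \<times> real \<Rightarrow> bool"
  assumes "AE z in lborel. z \<in> {0..1} \<times> {0..1} \<longrightarrow> P z"
  shows "AE z in unit_lborel \<Otimes>\<^sub>M unit_lborel. P z"
proof -
  interpret pair_sigma_finite unit_lborel unit_lborel ..
  obtain N where N: "\<And>z. z \<in> space lborel - N \<Longrightarrow> z \<in> {0..1} \<times> {0..1} \<longrightarrow> P z" "N \<in> null_sets lborel"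
    using AE_E3[OF assms] by blast
  have "AE z in lborel \<Otimes>\<^sub>M lborel. z \<notin> N"
    unfolding lborel_prod using N(2) by (rule AE_not_in)
  then have "AE x in lborel. AE y in lborel. (x, y) \<notin> N"
    by (rule lborel_pair.AE_pair)
  then have "AE x in unit_lborel. AE y in unit_lborel. (x, y) \<notin> N"
    by (intro AE_unit_lborelI, elim eventually_mono) (rule AE_unit_lborelI)
  moreover have "(\<lambda>z. z) \<in> unit_lborel \<Otimes>\<^sub>M unit_lborel \<rightarrow>\<^sub>M borel"
  proof -
    have "(\<lambda>z. (fst z, snd z)) \<in> unit_lborel \<Otimes>\<^sub>M unit_lborel \<rightarrow>\<^sub>M borel \<Otimes>\<^sub>M borel" by measurable
    then show ?thesis by (simp add: borel_prod)
  qed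
  then have "{z \<in> space (unit_lborel \<Otimes>\<^sub>M unit_lborel). z \<notin> N} \<in> sets (unit_lborel \<Otimes>\<^sub>M unit_lborel)"
  proof (rule measurable_sets_Collect)
    have "N \<in> sets borel" using N(2) by (simp add: null_sets_def)
    then have "- N \<in> sets borel" by (rule borel_comp)
    then show "{z \<in> space borel. z \<notin> N} \<in> sets borel" by (simp add: Compl_eq)
  qed
  ultimately have "AE z in unit_lborel \<Otimes>\<^sub>M unit_lborel. z \<notin> N"
    by (rule AE_pair_measure[rotated])
  then show ?thesis
    using AE_space
  proof eventually_elim
    case (elim z)
    then show ?case using N(1)[of z] by (auto simp: space_pair_measure space_unit_lborel)
  qed
qed

text \<open>Pulling back along two coordinates therefore turns null sets of the square into null sets of the
  cube. The coordinates must differ, which is where looplessness enters.\<close>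

lemma distr_unit_cube_two_coordinates:
  assumes ij: "i \<in> V" "j \<in> V" "i \<noteq> j"
  shows "distr (unit_cube V) (unit_lborel \<Otimes>\<^sub>M unit_lborel) (\<lambda>x. (x i, x j)) = unit_lborel \<Otimes>\<^sub>M unit_lborel"
proof (rule pair_measure_eqI[symmetric])
  interpret product_prob_space "\<lambda>_. unit_lborel" V by (rule product_prob_space_unit_lborel)
  show "sigma_finite_measure unit_lborel" "sigma_finite_measure unit_lborel" by unfold_locales
  fix A B assume AB: "A \<in> sets unit_lborel" "B \<in> sets unit_lborel"
  have m: "(\<lambda>x. (x i, x j)) \<in> unit_cube V \<rightarrow>\<^sub>M unit_lborel \<Otimes>\<^sub>M unit_lborel"
    using ij by (intro measurable_Pair measurable_component_singleton)
  have "(\<lambda>x. (x i, x j)) -` (A \<times> B) \<inter> space (unit_cube V)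
      = {x \<in> space (unit_cube V). \<forall>v\<in>{i, j}. x v \<in> (if v = i then A else B)}"
    using ij by auto
  then have "emeasure (distr (unit_cube V) (unit_lborel \<Otimes>\<^sub>M unit_lborel) (\<lambda>x. (x i, x j))) (A \<times> B)
      = emeasure (unit_cube V) {x \<in> space (unit_cube V). \<forall>v\<in>{i, j}. x v \<in> (if v = i then A else B)}"
    using AB by (subst emeasure_distr[OF m]) auto
  also have "\<dots> = (\<Prod>v\<in>{i, j}. emeasure unit_lborel (if v = i then A else B))"
    using ij AB by (intro emeasure_PiM_Collect) auto
  also have "\<dots> = emeasure unit_lborel A * emeasure unit_lborel B"
    using ij by simp
  finally show "emeasure unit_lborel A * emeasure unit_lborel B
    = emeasure (distr (unit_cube V) (unit_lborel \<Otimes>\<^sub>M unit_lborel) (\<lambda>x. (x i, x j))) (A \<times> B)" ..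
qed simp

lemma (in borel_graphon) measurable_prod_edge_weight:
  assumes "\<And>e. e \<in># E \<Longrightarrow> e \<subseteq> V \<and> card e = 2"
  shows "(\<lambda>x. \<Prod>e\<in>#E. edge_weight U x e) \<in> borel_measurable (unit_cube V)"
  using assms
proof (induction E)
  case (add e E)
  then show ?case by (auto intro!: borel_measurable_times measurable_edge_weight)
qed simp

lemma (in borel_graphon) prod_edge_weight_bounds:
  assumes "\<And>e. e \<in># E \<Longrightarrow> card e = 2"
  shows "0 \<le> (\<Prod>e\<in>#E. edge_weight U x e)" "(\<Prod>e\<in>#E. edge_weight U x e) \<le> 1"
  using assms
proof (induction E)
  case (add e E)
  {
    case 1
    then show ?case using add edge_weight_bounds(1)[of e x] by simp
  next
    case 2
    then show ?case using add edge_weight_bounds[of e x] by (simp add: mult_le_one)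
  }
qed simp_all

lemma (in borel_graphon) prod_edge_weight_cong:
  assumes "\<And>e. e \<in># E \<Longrightarrow> e \<subseteq> V \<and> card e = 2" "\<And>v. v \<in> V \<Longrightarrow> x v = y v"
  shows "(\<Prod>e\<in>#E. edge_weight U x e) = (\<Prod>e\<in>#E. edge_weight U y e)"
  using assms by (intro arg_cong[where f = prod_mset] image_mset_cong edge_weight_cong) auto

text \<open>Up to a null set the two integrands agree, as there are only finitely many edges; the completion
  makes the integrand of \<open>W\<close> measurable.\<close>

lemma hom_density_borel_version:
  fixes H :: "'a multigraph"
  assumes W: "graphon W" and U: "borel_graphon U"
    and UW: "AE z in lborel. z \<in> {0..1} \<times> {0..1} \<longrightarrow> U (fst z) (snd z) = W (fst z) (snd z)"
    and H: "is_multigraph H"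
  shows "hom_density H W = (LINT x|unit_cube (verts H). (\<Prod>e\<in>#edges H. edge_weight U x e))"
  unfolding hom_density_def
proof (rule integral_completion_cong_AE)
  interpret borel_graphon U by fact
  have H': "e \<subseteq> verts H" "card e = 2" if "e \<in># edges H" for e
    using H that by (auto simp: is_multigraph_def)
  show "(\<lambda>x. \<Prod>e\<in>#edges H. edge_weight U x e) \<in> borel_measurable (unit_cube (verts H))"
    using H' by (intro measurable_prod_edge_weight) auto
  have "AE x in unit_cube (verts H). edge_weight W x e = edge_weight U x e" if e: "e \<in># edges H" for e
  proof -
    obtain i j where ij: "e = {i, j}" "i \<noteq> j" using H'(2)[OF e] by (auto simp: card_2_iff)
    then have V: "i \<in> verts H" "j \<in> verts H" using H'(1)[OF e] by auto
    have "AE x in unit_cube (verts H). U (fst (x i, x j)) (snd (x i, x j)) = W (fst (x i, x j)) (snd (x i, x j))"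
    proof (rule AE_distrD[where M' = "unit_lborel \<Otimes>\<^sub>M unit_lborel"])
      show "(\<lambda>x. (x i, x j)) \<in> unit_cube (verts H) \<rightarrow>\<^sub>M unit_lborel \<Otimes>\<^sub>M unit_lborel"
        using V by (intro measurable_Pair measurable_component_singleton)
      show "AE z in distr (unit_cube (verts H)) (unit_lborel \<Otimes>\<^sub>M unit_lborel) (\<lambda>x. (x i, x j)).
          U (fst z) (snd z) = W (fst z) (snd z)"
        unfolding distr_unit_cube_two_coordinates[OF V ij(2)] using UW by (rule AE_unit_square)
    qed
    then show ?thesis
    proof (rule AE_mp, intro AE_I2 impI)
      fix x assume "x \<in> space (unit_cube (verts H))"
        and *: "U (fst (x i, x j)) (snd (x i, x j)) = W (fst (x i, x j)) (snd (x i, x j))"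
      then have "x i \<in> {0..1}" "x j \<in> {0..1}"
        using V by (auto simp: space_PiM space_unit_lborel PiE_iff)
      then show "edge_weight W x e = edge_weight U x e"
        using * W by (simp add: ij edge_weight_doubleton edge_weight_eq)
    qed
  qed
  then have "AE x in unit_cube (verts H). \<forall>e\<in>set_mset (edges H). edge_weight W x e = edge_weight U x e"
    by (intro AE_finite_allI) auto
  then show "AE x in unit_cube (verts H).
      (\<Prod>e\<in>#edges H. edge_weight W x e) = (\<Prod>e\<in>#edges H. edge_weight U x e)"
    by (rule eventually_mono) (auto intro!: arg_cong[where f = prod_mset] image_mset_cong)
qed

lemma dense_borel_version:
  assumes U: "borel_graphon U"
    and UW: "AE z in lborel. z \<in> {0..1} \<times> {0..1} \<longrightarrow> U (fst z) (snd z) = W (fst z) (snd z)"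
    and W: "locally_dense \<rho> W" and rho: "0 \<le> \<rho>"
  shows "dense_borel_graphon U \<rho>"
proof -
  interpret borel_graphon U by fact
  show ?thesis
  proof
    fix S :: "real set" assume S[measurable]: "S \<in> sets borel" and sub: "S \<subseteq> {0..1}"
    define g where "g z = indicator S (fst z) * indicator S (snd z) * U (fst z) (snd z)" for z
    have g[measurable]: "g \<in> borel_measurable (lborel \<Otimes>\<^sub>M lborel)"
      unfolding g_def[abs_def] by measurable
    have int_g: "integrable (lborel \<Otimes>\<^sub>M lborel) g"
    proof (rule Bochner_Integration.integrable_bound[OF _ g])
      show "integrable (lborel \<Otimes>\<^sub>M lborel) (indicator ({0..1} \<times> {0..1} :: (real \<times> real) set) :: _ \<Rightarrow> real)"
        unfolding lborel_prod
        by (intro integrable_real_indicator borel_closed[THEN sets_lborel[THEN equalityD2, THEN subsetD]]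
            emeasure_bounded_finite closed_Times bounded_Times) auto
      show "AE z in lborel \<Otimes>\<^sub>M lborel. norm (g z) \<le> norm (indicator ({0..1} \<times> {0..1}) z :: real)"
        using sub nonneg le_one by (intro AE_I2) (auto simp: g_def indicator_def)
    qed
    have "\<rho> * (measure unit_lborel S)\<^sup>2 = \<rho> * (measure lebesgue S)\<^sup>2"
      using S sub by (simp add: measure_unit_lborel measure_completion)
    also have "\<dots> \<le> (LINT z:S \<times> S|lebesgue. W (fst z) (snd z))"
      using W S sub unfolding locally_dense_def by (auto simp: measurable_completion)
    also have "\<dots> = integral\<^sup>L lborel g"
      unfolding set_lebesgue_integral_def
    proof (rule integral_completion_cong_AE)
      show "g \<in> borel_measurable lborel" using g by (simp add: lborel_prod)
      show "AE z in lborel. indicator (S \<times> S) z *\<^sub>R W (fst z) (snd z) = g z"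
        using UW by eventually_elim (use sub in \<open>auto simp: g_def indicator_def\<close>)
    qed
    also have "\<dots> = (LINT x|lborel. LINT y|lborel. g (x, y))"
      using lborel_pair.integral_fst'[OF int_g] by (simp add: lborel_prod)
    also have "\<dots> = (LINT x|unit_lborel. LINT y|unit_lborel. g (x, y))"
    proof -
      have I: "{0..1::real} \<inter> space lborel \<in> sets lborel" by simp
      have "indicator {0..1} y *\<^sub>R g (x, y) = g (x, y)"
        "indicator {0..1} x *\<^sub>R (LINT y|lborel. g (x, y)) = (LINT y|lborel. g (x, y))" for x y
        using sub by (auto simp: g_def indicator_def subset_iff)
      then show ?thesis by (simp only: integral_restrict_space[OF I])
    qed
    finally show "\<rho> * (measure unit_lborel S)\<^sup>2
        \<le> (LINT x|unit_lborel. LINT y|unit_lborel. indicator S x * indicator S y * U x y)"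
      by (simp add: g_def)
  qed (use rho in auto)
qed

section \<open>Two blocks of variables\<close>

text \<open>Functions of disjoint blocks of coordinates are independent, and the names of the coordinates do
  not matter. Here both blocks are copies of one index set \<open>V\<close>, embedded by \<open>p\<close> and \<open>q\<close>.\<close>

lemma integral_unit_cube_two_blocks:
  fixes p q :: "'a \<Rightarrow> 'b" and f g :: "('a \<Rightarrow> real) \<Rightarrow> real"
  assumes fin: "finite I" "finite J" "I \<inter> J = {}"
    and p: "inj_on p V" "p \<in> V \<rightarrow> I" and q: "inj_on q V" "q \<in> V \<rightarrow> J"
    and f: "f \<in> borel_measurable (unit_cube V)" "\<And>x. \<bar>f x\<bar> \<le> 1"
    and g: "g \<in> borel_measurable (unit_cube V)" "\<And>x. \<bar>g x\<bar> \<le> 1"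
  shows "(LINT x|unit_cube (I \<union> J). f (\<lambda>v\<in>V. x (p v)) * g (\<lambda>v\<in>V. x (q v)))
    = integral\<^sup>L (unit_cube V) f * integral\<^sup>L (unit_cube V) g"
proof -
  interpret product_prob_space "\<lambda>_. unit_lborel" by (rule product_prob_space_unit_lborel)
  have m: "(\<lambda>x. \<lambda>v\<in>V. x (r v)) \<in> unit_cube K \<rightarrow>\<^sub>M unit_cube V" if "r \<in> V \<rightarrow> K"
    for r :: "'a \<Rightarrow> 'b" and K
    using that by (intro measurable_restrict measurable_component_singleton) auto
  have reindex: "(LINT x|unit_cube K. u (\<lambda>v\<in>V. x (r v))) = integral\<^sup>L (unit_cube V) u"
    if "inj_on r V" "r \<in> V \<rightarrow> K" "u \<in> borel_measurable (unit_cube V)" for u :: "('a \<Rightarrow> real) \<Rightarrow> real" and r :: "'a \<Rightarrow> 'b" and K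
    using distr_PiM_reindex[of K "\<lambda>_. unit_lborel" r V] that prob_space_unit_lborel
      integral_distr[OF m[OF that(2)] that(3)] by simp
  have pI: "p \<in> V \<rightarrow> I \<union> J" and qJ: "q \<in> V \<rightarrow> I \<union> J" using p q by auto
  have "(LINT x|unit_cube (I \<union> J). f (\<lambda>v\<in>V. x (p v)) * g (\<lambda>v\<in>V. x (q v)))
     = (LINT x|unit_cube I. LINT y|unit_cube J.
          f (\<lambda>v\<in>V. merge I J (x, y) (p v)) * g (\<lambda>v\<in>V. merge I J (x, y) (q v)))"
  proof (intro product_integral_fold fin integrable_unit_cube[where B = 1])
    show "(\<lambda>x. f (\<lambda>v\<in>V. x (p v)) * g (\<lambda>v\<in>V. x (q v))) \<in> borel_measurable (unit_cube (I \<union> J))"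
      by (intro borel_measurable_times measurable_compose[OF m[OF pI] f(1)] measurable_compose[OF m[OF qJ] g(1)])
    show "\<bar>f (\<lambda>v\<in>V. x (p v)) * g (\<lambda>v\<in>V. x (q v))\<bar> \<le> 1" for x
      using f(2) g(2) by (simp add: abs_mult mult_le_one)
  qed
  also have "\<dots> = (LINT x|unit_cube I. LINT y|unit_cube J. f (\<lambda>v\<in>V. x (p v)) * g (\<lambda>v\<in>V. y (q v)))"
  proof -
    have "(\<lambda>v\<in>V. merge I J (x, y) (p v)) = (\<lambda>v\<in>V. x (p v))"
      "(\<lambda>v\<in>V. merge I J (x, y) (q v)) = (\<lambda>v\<in>V. y (q v))" for x y :: "'b \<Rightarrow> real"
      using p(2) q(2) fin(3) by (auto simp: merge_def restrict_def fun_eq_iff)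
    then show ?thesis by simp
  qed
  also have "\<dots> = (LINT x|unit_cube I. f (\<lambda>v\<in>V. x (p v))) * (LINT y|unit_cube J. g (\<lambda>v\<in>V. y (q v)))"
    by simp
  finally show ?thesis using reindex[OF p f(1)] reindex[OF q g(1)] by simp
qed

text \<open>By the inequality of arithmetic and geometric means, \<open>2 t h \<le> t\<^sup>2 f + g\<close> for every \<open>t > 0\<close>.
  After integration, a suitable choice of \<open>t\<close> gives the claim.\<close>

lemma (in prob_space) Cauchy_Schwarz_expectation:
  fixes f g h :: "'a \<Rightarrow> real"
  assumes int: "integrable M f" "integrable M g" "integrable M h"
    and nn: "\<And>x. 0 \<le> f x" "\<And>x. 0 \<le> g x" and fgh: "\<And>x. f x * g x = (h x)\<^sup>2"
    and h: "0 \<le> expectation h"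
  shows "(expectation h)\<^sup>2 \<le> expectation f * expectation g"
proof -
  define A B C where "A = expectation f" "B = expectation g" "C = expectation h"
  have nnAB: "0 \<le> A" "0 \<le> B" unfolding A_B_C_def using nn by (auto intro!: integral_nonneg_AE)
  have quad: "2 * t * C \<le> t\<^sup>2 * A + B" if "t > 0" for t
  proof -
    have "2 * t * h x \<le> t\<^sup>2 * f x + g x" for x
    proof -
      have "(2 * t * h x)\<^sup>2 = 4 * ((t\<^sup>2 * f x) * g x)"
        using fgh[of x] by (simp add: power_mult_distrib)
      also have "\<dots> \<le> (t\<^sup>2 * f x + g x)\<^sup>2"
        using zero_le_power2[of "t\<^sup>2 * f x - g x"] by (simp add: power2_eq_square algebra_simps)
      finally show ?thesis
        using nn by (intro power2_le_imp_le[of "2 * t * h x"]) auto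
    qed
    then have "(LINT x|M. 2 * t * h x) \<le> (LINT x|M. t\<^sup>2 * f x + g x)"
      using int by (intro integral_mono) auto
    then show ?thesis using int by (simp add: A_B_C_def)
  qed
  show ?thesis
  proof (cases "C = 0")
    case False
    then have C: "C > 0" using h by (simp add: A_B_C_def)
    show ?thesis
    proof (cases "A = 0")
      case True
      \<comment> \<open>This case is contradictory: \<open>2 t C \<le> B\<close> fails for large \<open>t\<close>.\<close>
      have "2 * ((B + 1) / C) * C \<le> B" using quad[of "(B + 1) / C"] C nnAB True by simp
      then show ?thesis using C nnAB by simp
    next
      case False
      then have A: "A > 0" using nnAB by simp
      \<comment> \<open>\<open>t = C / A\<close> minimises \<open>t\<^sup>2 A + B - 2 t C\<close>.\<close>
      have "2 * (C / A) * C \<le> (C / A)\<^sup>2 * A + B" using C A by (intro quad) simp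
      then have "C\<^sup>2 \<le> A * B" using A by (simp add: power2_eq_square field_simps)
      then show ?thesis by (simp add: A_B_C_def)
    qed
  qed (use nnAB in \<open>simp add: A_B_C_def\<close>)
qed

section \<open>Completing a graph to a KNRS multigraph\<close>

lemma edges_subset_clique:
  assumes "is_simple_graph H"
  shows "edges H \<subseteq># mset_set (clique_edges (verts H))"
proof (rule mset_subset_eqI)
  fix e
  have "finite (clique_edges (verts H))"
    using assms by (simp add: is_simple_graph_def is_multigraph_def finite_clique_edges)
  moreover have "e \<in> clique_edges (verts H)" if "e \<in># edges H"
    using assms that by (auto simp: is_simple_graph_def is_multigraph_def clique_edges_def)
  ultimately show "count (edges H) e \<le> count (mset_set (clique_edges (verts H))) e"
    using assms by (cases "e \<in># edges H") (auto simp: is_simple_graph_def not_in_iff)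
qed

theorem corollary1p7:
  fixes H :: "'a multigraph"
  assumes "is_simple_graph H"
  shows "\<exists>H' :: nat multigraph. is_multigraph H' \<and> KNRS (disjoint_union H H')"
proof -
  define V where "V = verts H"
  define E where "E = edges H"
  define K where "K = mset_set (clique_edges V)"
  \<comment> \<open>The complement of \<open>H\<close> in the doubled complete graph: non-edges of \<open>H\<close> twice, edges once.\<close>
  define E' where "E' = K + K - E"
  have H: "is_multigraph H" using assms by (simp add: is_simple_graph_def)
  have fin: "finite V" using H by (simp add: V_def is_multigraph_def)
  have E: "e \<subseteq> V" "card e = 2" if "e \<in># E" for e
    using H that by (auto simp: is_multigraph_def V_def E_def)
  have finK: "finite (clique_edges V)" using fin by (rule finite_clique_edges)
  have K: "e \<subseteq> V" "card e = 2" if "e \<in># K" for e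
    using that finK by (auto simp: K_def clique_edges_def)
  have EE': "E + E' = K + K"
    using edges_subset_clique[OF assms] unfolding E'_def E_def K_def V_def
    by (metis add_diff_cancel_left' subset_mset.add_increasing2 subset_mset.add_diff_inverse subset_mset.zero_le)
  have E': "e \<subseteq> V" "card e = 2" if "e \<in># E'" for e
    using K[of e] in_diffD[of e "K + K" E] that by (simp_all add: E'_def)
  \<comment> \<open>A copy on natural numbers; only the names of the vertices change.\<close>
  obtain h where h: "bij_betw h V {..<card V}"
    using ex_bij_betw_finite_nat[OF fin] atLeast0LessThan by metis
  then have inj: "inj_on h V" by (simp add: bij_betw_def)
  define H' :: "nat multigraph" where "H' = \<lparr>verts = h ` V, edges = image_mset (image h) E'\<rparr>"
  have card_h: "card (h ` e) = 2" if "e \<in># E'" for e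
    using E'[OF that] inj by (metis card_image inj_on_subset)
  have H': "is_multigraph H'"
    using fin E' card_h by (auto simp: is_multigraph_def H'_def)
  let ?D = "disjoint_union H H'"
  have D: "is_multigraph ?D" using H H' by (rule is_multigraph_disjoint_union)
  have "KNRS ?D" unfolding KNRS_def
  proof (intro ballI allI impI)
    fix \<rho> :: real and W
    assume \<rho>: "\<rho> \<in> {0..1}" and W: "graphon W" "locally_dense \<rho> W"
    obtain U where U: "borel_graphon U"
      and UW: "AE z in lborel. z \<in> {0..1} \<times> {0..1} \<longrightarrow> U (fst z) (snd z) = W (fst z) (snd z)"
      using graphon_borel_version[OF W(1)] .
    interpret dense_borel_graphon U \<rho>
      using dense_borel_version[OF U UW W(2)] \<rho> by simp
    interpret cube: prob_space "unit_cube V" by (rule prob_space_unit_cube)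
    let ?w = "\<lambda>E x. \<Prod>e\<in>#E. edge_weight U x e"
    have int: "integrable (unit_cube V) (?w F)" if "\<And>e. e \<in># F \<Longrightarrow> e \<subseteq> V \<and> card e = 2" for F
      using that prod_edge_weight_bounds[of F]
      by (intro integrable_unit_cube[where B = 1] measurable_prod_edge_weight) auto
    have "\<rho> ^ (card V choose 2) \<le> (LINT x|unit_cube V. ?w K x)"
      using clique_density[OF fin] by (simp add: K_def prod_unfold_prod_mset)
    then have "(\<rho> ^ (card V choose 2))\<^sup>2 \<le> (LINT x|unit_cube V. ?w K x)\<^sup>2"
      using \<rho> by (intro power_mono) auto
    also have "\<dots> \<le> (LINT x|unit_cube V. ?w E x) * (LINT x|unit_cube V. ?w E' x)"
    proof (rule cube.Cauchy_Schwarz_expectation)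
      show "?w E x * ?w E' x = (?w K x)\<^sup>2" for x
      proof -
        have "?w E x * ?w E' x = ?w (E + E') x" by simp
        also have "\<dots> = (?w K x)\<^sup>2" unfolding EE' by (simp add: power2_eq_square)
        finally show ?thesis .
      qed
      show "0 \<le> (LINT x|unit_cube V. ?w K x)"
        using K prod_edge_weight_bounds(1)[of K] by (intro integral_nonneg_AE AE_I2) auto
    qed (simp_all add: int prod_edge_weight_bounds(1) E E' K)
    also have "\<dots> = (LINT x|unit_cube (Inl ` V \<union> Inr ` (h ` V)).
        ?w E (\<lambda>v\<in>V. x (Inl v)) * ?w E' (\<lambda>v\<in>V. x (Inr (h v))))"
      using fin inj E E' prod_edge_weight_bounds[of E] prod_edge_weight_bounds[of E']
      by (intro integral_unit_cube_two_blocks[symmetric, where p = Inl and q = "\<lambda>v. Inr (h v)"]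
           measurable_prod_edge_weight)
         (auto simp: inj_on_def)
    also have "\<dots> = (LINT x|unit_cube (verts ?D). ?w (edges ?D) x)"
    proof (rule Bochner_Integration.integral_cong)
      show "unit_cube (Inl ` V \<union> Inr ` (h ` V)) = unit_cube (verts ?D)"
        by (simp add: disjoint_union_def H'_def V_def Plus_def)
      fix x :: "'a + nat \<Rightarrow> real"
      have "?w E (\<lambda>v\<in>V. x (Inl v)) = ?w E (\<lambda>v. x (Inl v))"
        using E by (intro prod_edge_weight_cong[of E V]) auto
      also have "\<dots> = ?w (image_mset (image Inl) E) x"
        using E by (auto simp: multiset.map_comp edge_weight_image intro!: arg_cong[where f = prod_mset] image_mset_cong)
      finally have 1: "?w E (\<lambda>v\<in>V. x (Inl v)) = ?w (image_mset (image Inl) E) x" .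
      have "?w E' (\<lambda>v\<in>V. x (Inr (h v))) = ?w E' (\<lambda>v. x (Inr (h v)))"
        using E' by (intro prod_edge_weight_cong[of E' V]) auto
      also have "\<dots> = ?w (image_mset (image Inr) (image_mset (image h) E')) x"
        using E' card_h by (auto simp: multiset.map_comp edge_weight_image intro!: arg_cong[where f = prod_mset] image_mset_cong)
      finally have 2: "?w E' (\<lambda>v\<in>V. x (Inr (h v))) = ?w (image_mset (image Inr) (image_mset (image h) E')) x" .
      show "?w E (\<lambda>v\<in>V. x (Inl v)) * ?w E' (\<lambda>v\<in>V. x (Inr (h v))) = ?w (edges ?D) x"
        unfolding 1 2 by (simp add: disjoint_union_def H'_def E_def)
    qed
    also have "\<dots> = hom_density ?D W"
      using hom_density_borel_version[OF W(1) U UW D] by simp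
    also have "(\<rho> ^ (card V choose 2))\<^sup>2 = \<rho> ^ size (edges ?D)"
    proof -
      have "size (edges ?D) = size (E + E')" by (simp add: disjoint_union_def H'_def E_def)
      also have "\<dots> = (card V choose 2) * 2"
        unfolding EE' using fin by (simp add: K_def card_clique_edges)
      finally show ?thesis by (simp add: power_mult)
    qed
    finally show "hom_density ?D W \<ge> \<rho> ^ size (edges ?D)" .
  qed
  with H' show ?thesis by blast
qed

end
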